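(* Let $d\in(0,\tfrac14)$. In the positive square model at density $d$ a random group is free with overwhelming probability.
   Context: Positive square model: for $n\ge 1$ let $A_n=\{a_1,\dots,a_n\}$, let $F_n$ be the free group on $A_n$, and let $W_n$ be the set of the $n^4$ positive words of length four over $A_n$ (words using only the letters $a_i$, no inverses). For $d\in(0,1)$ choose a subset $R_n\subset W_n$ with $|R_n|=\lfloor n^{4d}\rfloor$ uniformly at random among all subsets of that size. The quotient $G=\langle A_n\mid R_n\rangle$ of $F_n$ by the normal closure of $R_n$ is a random group in the positive square model at density $d$. A property holds with overwhelming probability if the probability that the random group has it tends to $1$ as $n\to\infty$. *)

theory Defs
  imports "HOL-Algebra.Coset" "HOL-Probability.Probability"
begin

section \<open>Free groups\<close>

text \<open>A letter \<open>(x, True)\<close> stands for the generator \<open>x\<close>, and \<open>(x, False)\<close> for its formal inverse.\<close>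

type_synonym 'a word = "('a \<times> bool) list"

fun inv_letter :: "'a \<times> bool \<Rightarrow> 'a \<times> bool" where
  "inv_letter (x, b) = (x, \<not> b)"

definition reduced :: "'a word \<Rightarrow> bool" where
  "reduced w \<longleftrightarrow> successively (\<lambda>k l. l \<noteq> inv_letter k) w"

text \<open>Left multiplication of a reduced word by a single letter, with cancellation.\<close>

fun cons_reduce :: "'a \<times> bool \<Rightarrow> 'a word \<Rightarrow> 'a word" where
  "cons_reduce l [] = [l]"
| "cons_reduce l (k # w) = (if k = inv_letter l then w else l # k # w)"

text \<open>The free group on \<open>X\<close>: reduced words, multiplied by concatenation followed by reduction.\<close>

definition free_group :: "'a set \<Rightarrow> 'a word monoid" where
  "free_group X =
     \<lparr>carrier = {w. set w \<subseteq> X \<times> UNIV \<and> reduced w},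
      monoid.mult = (\<lambda>u v. foldr cons_reduce u v),
      one = []\<rparr>"

text \<open>
  The basis may have any cardinality, including \<open>0\<close>, so the trivial group is free. Letting \<open>X\<close> range
  over sets of elements of the type underlying \<open>G\<close> is no restriction: a free basis can be
  taken to consist of elements of \<open>G\<close>.
\<close>

definition is_free_group :: "('g, 'm) monoid_scheme \<Rightarrow> bool" where
  "is_free_group G \<longleftrightarrow> group G \<and> (\<exists>X :: 'g set. G \<cong> free_group X)"


section \<open>Group presentations\<close>

definition normal_closure :: "('g, 'm) monoid_scheme \<Rightarrow> 'g set \<Rightarrow> 'g set" where
  "normal_closure G S = \<Inter> {N. N \<lhd> G \<and> S \<subseteq> N}"

definition presented_group :: "'a set \<Rightarrow> 'a word set \<Rightarrow> 'a word set monoid" where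
  "presented_group A R = free_group A Mod normal_closure (free_group A) R"


section \<open>The positive square model\<close>

text \<open>The generator \<open>a\<^sub>i\<close> is represented by the number \<open>i\<close>.\<close>

definition gens :: "nat \<Rightarrow> nat set" where
  "gens n = {1..n}"

text \<open>Positive words contain no cancelling pair, so they are elements of the free group as they stand.\<close>

definition positive_words :: "nat \<Rightarrow> nat word set" where
  "positive_words n = {w. length w = 4 \<and> set w \<subseteq> gens n \<times> {True}}"

definition relator_sets :: "real \<Rightarrow> nat \<Rightarrow> nat word set set" where
  "relator_sets d n =
     {R. R \<subseteq> positive_words n \<and> card R = nat \<lfloor>real n powr (4 * d)\<rfloor>}"

definition positive_square_model :: "real \<Rightarrow> nat \<Rightarrow> nat word set monoid pmf" where
  "positive_square_model d n =
     map_pmf (presented_group (gens n)) (pmf_of_set (relator_sets d n))"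

definition with_overwhelming_probability ::
    "(nat \<Rightarrow> 'g pmf) \<Rightarrow> ('g \<Rightarrow> bool) \<Rightarrow> bool" where
  "with_overwhelming_probability M P \<longleftrightarrow>
     (\<lambda>n. measure_pmf.prob (M n) {G. P G}) \<longlonglongrightarrow> 1"


section \<open>Basic facts\<close>

lemma inv_letter_inv_letter [simp]: "inv_letter (inv_letter l) = l"
  by (cases l) auto

lemma inv_letter_eq_iff: "k = inv_letter l \<longleftrightarrow> l = inv_letter k"
  by auto

lemma inv_letter_neq [simp]: "inv_letter l \<noteq> l" "l \<noteq> inv_letter l"
  by (cases l; auto)+

lemma reduced_Nil [simp]: "reduced []"
  by (simp add: reduced_def)

lemma reduced_Cons: "reduced (l # w) \<longleftrightarrow> reduced w \<and> (w = [] \<or> hd w \<noteq> inv_letter l)"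
  by (cases w) (auto simp: reduced_def)

lemma reduced_cons_reduce: "reduced w \<Longrightarrow> reduced (cons_reduce l w)"
  by (cases w) (auto simp: reduced_Cons)

lemma reduced_foldr: "reduced w \<Longrightarrow> reduced (foldr cons_reduce u w)"
  by (induction u) (auto simp: reduced_cons_reduce)

lemma set_cons_reduce: "set (cons_reduce l w) \<subseteq> insert l (set w)"
  by (cases w) auto

lemma set_foldr: "set (foldr cons_reduce u w) \<subseteq> set u \<union> set w"
proof (induction u)
  case (Cons l u)
  then show ?case using set_cons_reduce[of l "foldr cons_reduce u w"] by auto
qed simp

lemma cons_reduce_cancel:
  "reduced w \<Longrightarrow> cons_reduce l (cons_reduce (inv_letter l) w) = w"
  by (cases w; cases "tl w") (auto simp: reduced_Cons)

lemma foldr_cons_reduce: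
  assumes "reduced w"
  shows "foldr cons_reduce (cons_reduce l u) w = cons_reduce l (foldr cons_reduce u w)"
proof (cases u)
  case (Cons k v)
  then show ?thesis
    using cons_reduce_cancel[OF reduced_foldr[OF assms], of l v] by auto
qed simp

lemma foldr_assoc:
  assumes "reduced w"
  shows "foldr cons_reduce (foldr cons_reduce u v) w = foldr cons_reduce u (foldr cons_reduce v w)"
  by (induction u) (simp_all add: foldr_cons_reduce[OF assms])

lemma foldr_Nil: "reduced w \<Longrightarrow> foldr cons_reduce w [] = w"
proof (induction w)
  case (Cons l w)
  then show ?case by (cases w) (auto simp: reduced_Cons)
qed simp

lemma foldr_inverse: "foldr cons_reduce (rev (map inv_letter w)) w = []"
  by (induction w) auto

lemma reduced_inverse: "reduced w \<Longrightarrow> reduced (rev (map inv_letter w))"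
  unfolding reduced_def successively_rev successively_map
  by (erule successively_mono) (metis inv_letter_inv_letter)

lemma group_free_group: "group (free_group X)"
proof (rule groupI)
  fix w assume w: "w \<in> carrier (free_group X)"
  have "set (rev (map inv_letter w)) \<subseteq> X \<times> UNIV"
    using w by (force simp: free_group_def)
  then have "rev (map inv_letter w) \<in> carrier (free_group X)"
    using w by (auto simp: free_group_def reduced_inverse)
  then show "\<exists>v\<in>carrier (free_group X). v \<otimes>\<^bsub>free_group X\<^esub> w = \<one>\<^bsub>free_group X\<^esub>"
    by (rule bexI[rotated]) (simp add: free_group_def foldr_inverse)
next
  fix u v assume "u \<in> carrier (free_group X)" "v \<in> carrier (free_group X)"
  then show "u \<otimes>\<^bsub>free_group X\<^esub> v \<in> carrier (free_group X)"
    using set_foldr[of u v] by (auto simp: free_group_def reduced_foldr)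
qed (auto simp: free_group_def foldr_assoc)

lemma normal_closure_normal:
  assumes "group G" "S \<subseteq> carrier G"
  shows "normal_closure G S \<lhd> G" "S \<subseteq> normal_closure G S"
proof -
  interpret group G by fact
  let ?C = "{N. N \<lhd> G \<and> S \<subseteq> N}"
  have "carrier G \<in> ?C"
    using assms(2) normal_invI[OF subgroup_self] by auto
  then have ne: "?C \<noteq> {}" by blast
  have "subgroup (\<Inter>?C) G"
    by (rule subgroups_Inter[OF _ ne]) (auto simp: normal_imp_subgroup)
  moreover have "x \<otimes>\<^bsub>G\<^esub> h \<otimes>\<^bsub>G\<^esub> inv\<^bsub>G\<^esub> x \<in> \<Inter>?C" if "x \<in> carrier G" "h \<in> \<Inter>?C" for x h
    using that by (auto intro: normal.inv_op_closed2)
  ultimately show "normal_closure G S \<lhd> G"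
    unfolding normal_closure_def by (rule normal_invI)
  show "S \<subseteq> normal_closure G S"
    by (auto simp: normal_closure_def)
qed

lemma positive_words_subset: "positive_words n \<subseteq> carrier (free_group (gens n))"
proof -
  have "reduced w" if "set w \<subseteq> gens n \<times> {True}" for w
    using that
  proof (induction w)
    case (Cons l w)
    then show ?case by (cases w) (auto simp: reduced_Cons)
  qed simp
  then show ?thesis by (auto simp: positive_words_def free_group_def)
qed

lemma group_presented_group:
  assumes "R \<subseteq> carrier (free_group A)"
  shows "group (presented_group A R)"
  unfolding presented_group_def
  using assms by (intro normal.factorgroup_is_group normal_closure_normal group_free_group)

lemma card_positive_words: "finite (positive_words n)" "card (positive_words n) = n ^ 4"
  using finite_lists_length_eq[of "gens n \<times> {True}" 4] card_lists_length_eq[of "gens n \<times> {True}" 4]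
  by (simp_all add: positive_words_def gens_def conj_commute card_cartesian_product)

lemma finite_relator_sets: "finite (relator_sets d n)"
  by (rule finite_subset[of _ "Pow (positive_words n)"])
     (auto simp: relator_sets_def card_positive_words)

lemma relator_sets_nonempty:
  assumes "n \<ge> 1" "d \<le> 1"
  shows "relator_sets d n \<noteq> {}"
proof -
  have "real n powr (4 * d) \<le> real n powr 4"
    using assms by (intro powr_mono) auto
  also have "\<dots> = real (n ^ 4)"
    using assms by simp
  finally have "nat \<lfloor>real n powr (4 * d)\<rfloor> \<le> n ^ 4"
    by linarith
  then obtain R where "R \<subseteq> positive_words n" "card R = nat \<lfloor>real n powr (4 * d)\<rfloor>"
    using obtain_subset_with_card_n[of _ "positive_words n"] card_positive_words by metis
  then show ?thesis by (auto simp: relator_sets_def)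
qed

end

theory Submission
  imports Defs "HOL-Real_Asymp.Real_Asymp"
begin

text \<open>
  Suppose that every nonempty set \<open>S\<close> of relators has a letter occurring exactly once in \<open>S\<close>,
  counted with multiplicity. Then some relator contains a generator exactly once that no other
  relator contains; a Tietze transformation removes both, and by induction the group is free.
  If a set \<open>S\<close> of \<open>k\<close> positive words of length four has no such letter, then each of its letters
  occurs at least twice among the \<open>4k\<close> positions, so \<open>S\<close> uses at most \<open>2k\<close> letters. For \<open>m = n\<^sup>4\<^sup>d\<close>
  relators, the expected number of such sets is at most
  \<open>(n choose 2k) ((2k)\<^sup>4 choose k) (m / n\<^sup>4)\<^sup>k \<le> (4 e\<^sup>3 m\<^sup>2 / n\<^sup>2)\<^sup>k\<close>, and the sum over \<open>k \<ge> 1\<close> tends to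
  \<open>0\<close> because \<open>m / n\<close> does.
\<close>

section \<open>Homomorphisms from free groups\<close>

lemma free_group_simps [simp]:
  "u \<otimes>\<^bsub>free_group X\<^esub> v = foldr cons_reduce u v"
  "\<one>\<^bsub>free_group X\<^esub> = []"
  by (simp_all add: free_group_def)

lemma carrier_free_group: "w \<in> carrier (free_group X) \<longleftrightarrow> set w \<subseteq> X \<times> UNIV \<and> reduced w"
  by (simp add: free_group_def)

lemma inv_free_group:
  assumes "w \<in> carrier (free_group X)"
  shows "inv\<^bsub>free_group X\<^esub> w = rev (map inv_letter w)"
proof (rule group.inv_equality[OF group_free_group])
  show "rev (map inv_letter w) \<in> carrier (free_group X)"
    using assms by (force simp: carrier_free_group reduced_inverse)
qed (use assms in \<open>simp_all add: foldr_inverse\<close>)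

lemma generator_in_free_group: "a \<in> X \<Longrightarrow> [(a, b)] \<in> carrier (free_group X)"
  by (simp add: carrier_free_group reduced_def)

lemma reduced_appendD:
  assumes "reduced (u @ v)"
  shows "reduced u" "reduced v"
  using assms by (auto simp: reduced_def successively_append_iff)

text \<open>A reduced word is a product of its pieces with no cancellation, so a homomorphism can be
  evaluated at a chosen letter \<open>l\<close>.\<close>

lemma split_as_product:
  assumes "reduced (u @ l # v)"
  shows "u @ l # v = foldr cons_reduce u (foldr cons_reduce [l] v)"
proof -
  have "reduced v"
    using assms reduced_appendD(2)[of "u @ [l]" v] by simp
  then have "foldr cons_reduce (u @ l # v) [] = foldr cons_reduce u (foldr cons_reduce [l] v)"
    by (simp add: foldr_Nil)
  then show ?thesis
    using foldr_Nil[OF assms] by simp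
qed

section \<open>The universal property of free groups\<close>

definition free_lift :: "('b, 'm) monoid_scheme \<Rightarrow> ('a \<Rightarrow> 'b) \<Rightarrow> 'a word \<Rightarrow> 'b" where
  "free_lift H f w =
     foldr (\<lambda>(a, b) h. (if b then f a else inv\<^bsub>H\<^esub> f a) \<otimes>\<^bsub>H\<^esub> h) w \<one>\<^bsub>H\<^esub>"

lemma free_lift_simps:
  "free_lift H f [] = \<one>\<^bsub>H\<^esub>"
  "free_lift H f ((a, b) # w) = (if b then f a else inv\<^bsub>H\<^esub> f a) \<otimes>\<^bsub>H\<^esub> free_lift H f w"
  by (simp_all add: free_lift_def)

context group
begin

lemma free_lift_closed:
  assumes "f ` X \<subseteq> carrier G" "set w \<subseteq> X \<times> UNIV"
  shows "free_lift G f w \<in> carrier G"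
  using assms(2)
proof (induction w)
  case (Cons l w)
  then show ?case
    using assms(1) by (cases l) (auto simp: free_lift_simps)
qed (simp add: free_lift_simps)

text \<open>A cancellation in the word is invisible in the target, where \<open>f a\<close> meets
  its own inverse. Hence \<open>w\<close> need not be reduced.\<close>

lemma free_lift_cons_reduce:
  assumes "f ` X \<subseteq> carrier G" "a \<in> X" "set w \<subseteq> X \<times> UNIV"
  shows "free_lift G f (cons_reduce (a, b) w) = free_lift G f ((a, b) # w)"
proof (cases "w \<noteq> [] \<and> hd w = (a, \<not> b)")
  case True
  then obtain v where w: "w = (a, \<not> b) # v"
    by (cases w) auto
  have "f a \<in> carrier G" "free_lift G f v \<in> carrier G"
    using assms free_lift_closed[OF assms(1), of v] by (auto simp: w)
  then show ?thesis
    by (auto simp: w free_lift_simps m_assoc[symmetric])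
qed (cases w; auto)

lemma free_lift_mult:
  assumes "f ` X \<subseteq> carrier G" "set u \<subseteq> X \<times> UNIV" "set v \<subseteq> X \<times> UNIV"
  shows "free_lift G f (foldr cons_reduce u v) = free_lift G f u \<otimes> free_lift G f v"
  using assms(2)
proof (induction u)
  case Nil
  then show ?case
    using free_lift_closed[OF assms(1,3)] by (simp add: free_lift_simps)
next
  case (Cons l u)
  obtain a b where l: "l = (a, b)" by fastforce
  have "set (foldr cons_reduce u v) \<subseteq> X \<times> UNIV"
    using set_foldr[of u v] Cons.prems assms(3) by auto
  then have "free_lift G f (foldr cons_reduce (l # u) v)
      = free_lift G f ((a, b) # foldr cons_reduce u v)"
    using free_lift_cons_reduce[OF assms(1), of a _ b] Cons.prems by (simp add: l)
  moreover have "free_lift G f u \<in> carrier G" "free_lift G f v \<in> carrier G" "f a \<in> carrier G"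
    using free_lift_closed[OF assms(1)] Cons.prems assms(1,3) by (auto simp: l)
  ultimately show ?case
    using Cons by (simp add: l free_lift_simps m_assoc)
qed

lemma free_lift_hom:
  assumes "f ` X \<subseteq> carrier G"
  shows "free_lift G f \<in> hom (free_group X) G"
  by (rule homI)
    (simp_all add: carrier_free_group free_lift_closed[OF assms] free_lift_mult[OF assms])

lemma free_lift_generator: "f a \<in> carrier G \<Longrightarrow> free_lift G f [(a, True)] = f a"
  by (simp add: free_lift_simps)

text \<open>This is the uniqueness half of the universal property: the value on
  \<open>[(a, True)]\<close> forces the value on its inverse, and a reduced word is the product of
  its letters.\<close>

lemma hom_eq_free_lift:
  assumes "h \<in> hom (free_group X) G" "w \<in> carrier (free_group X)"
  shows "h w = free_lift G (\<lambda>a. h [(a, True)]) w"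
  using assms(2)
proof (induction w)
  interpret h: group_hom "free_group X" G h
    using assms(1) by (intro group_hom.intro group_hom_axioms.intro group_free_group is_group)
  {
    case Nil
    show ?case
      using h.hom_one by (simp add: free_lift_simps)
  next
    case (Cons l w)
    obtain a b where l: "l = (a, b)" by fastforce
    have aX: "a \<in> X" and w: "w \<in> carrier (free_group X)"
      using Cons.prems by (auto simp: l carrier_free_group reduced_Cons)
    have "[l] \<otimes>\<^bsub>free_group X\<^esub> w = l # w"
      using split_as_product[of "[]" l w] Cons.prems by (simp add: carrier_free_group)
    then have "h (l # w) = h [l] \<otimes> h w"
      using h.hom_mult[of "[l]" w] w generator_in_free_group[OF aX] by (simp add: l)
    moreover have "h [(a, False)] = inv h [(a, True)]"
      using h.hom_inv[OF generator_in_free_group[OF aX, of True]]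
        inv_free_group[OF generator_in_free_group[OF aX, of True]] by simp
    ultimately show ?case
      using Cons.IH[OF w] by (simp add: l free_lift_simps)
  }
qed

lemma free_group_hom_eqI:
  assumes "h \<in> hom (free_group X) G" "h' \<in> hom (free_group X) G"
    and "\<And>a. a \<in> X \<Longrightarrow> h [(a, True)] = h' [(a, True)]"
    and w: "w \<in> carrier (free_group X)"
  shows "h w = h' w"
proof -
  have "free_lift G (\<lambda>a. h [(a, True)]) w = free_lift G (\<lambda>a. h' [(a, True)]) w"
    unfolding free_lift_def
    using w assms(3) by (intro foldr_cong) (auto simp: carrier_free_group)
  then show ?thesis
    using hom_eq_free_lift[OF assms(1) w] hom_eq_free_lift[OF assms(2) w] by simp
qed

end

section \<open>Smaller and renamed bases\<close>

lemma free_group_subset: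
  assumes "Y \<subseteq> X"
  shows "subgroup (carrier (free_group Y)) (free_group X)"
    and "free_group Y = free_group X \<lparr>carrier := carrier (free_group Y)\<rparr>"
proof -
  show eq: "free_group Y = free_group X \<lparr>carrier := carrier (free_group Y)\<rparr>"
    by (simp add: free_group_def)
  have "carrier (free_group Y) \<subseteq> carrier (free_group X)"
    using assms by (fastforce simp: carrier_free_group)
  then show "subgroup (carrier (free_group Y)) (free_group X)"
    using group.group_incl_imp_subgroup[OF group_free_group] group_free_group[of Y] eq by metis
qed

text \<open>An injective renaming of generators preserves which letters are mutually inverse, so it
  commutes with cancellation. It serves to move a basis into the element type demanded by
  \<open>is_free_group\<close>.\<close>

lemma free_group_iso_image:
  assumes "inj f"
  shows "free_group X \<cong> free_group (f ` X)"
proof -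
  let ?h = "map (map_prod f (\<lambda>c. c))"
  have letter: "map_prod f (\<lambda>c. c) k = inv_letter (map_prod f (\<lambda>c. c) l) \<longleftrightarrow> k = inv_letter l" for k l
    using assms by (cases k; cases l) (auto dest: injD)
  have step: "?h (cons_reduce l w) = cons_reduce (map_prod f (\<lambda>c. c) l) (?h w)" for l w
    by (cases w) (simp_all add: letter)
  have mult: "?h (foldr cons_reduce u v) = foldr cons_reduce (?h u) (?h v)" for u v
    by (induction u) (simp_all add: step)
  have red: "reduced (?h w) \<longleftrightarrow> reduced w" for w
    by (simp add: reduced_def successively_map letter)
  have inj: "inj ?h"
    using assms by (simp add: prod.inj_map)
  have img: "?h ` carrier (free_group X) = carrier (free_group (f ` X))"
  proof (intro equalityI subsetI)
    fix w assume w: "w \<in> carrier (free_group (f ` X))"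
    then have "w \<in> lists (map_prod f (\<lambda>c. c) ` (X \<times> UNIV))"
      by (auto simp: carrier_free_group)
    then obtain v where v: "set v \<subseteq> X \<times> UNIV" "w = ?h v"
      by (auto simp: lists_image)
    then have "v \<in> carrier (free_group X)"
      using w by (simp add: carrier_free_group red)
    then show "w \<in> ?h ` carrier (free_group X)"
      using v by blast
  qed (fastforce simp: carrier_free_group red)
  have "?h \<in> iso (free_group X) (free_group (f ` X))"
    using img inj_on_subset[OF inj]
    by (auto simp: iso_def hom_def bij_betw_def mult)
  then show ?thesis
    by (auto simp: is_iso_def)
qed


section \<open>Eliminating a generator\<close>

lemma normal_closure_minimal: "N \<lhd> G \<Longrightarrow> S \<subseteq> N \<Longrightarrow> normal_closure G S \<subseteq> N"
  by (auto simp: normal_closure_def)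

lemma presented_group_empty: "presented_group A {} \<cong> free_group A"
proof -
  interpret group "free_group A" by (rule group_free_group)
  have "normal_closure (free_group A) {} = {\<one>\<^bsub>free_group A\<^esub>}"
    using normal_closure_minimal[OF one_is_normal, of "{}"]
      normal_imp_subgroup[OF normal_closure_normal(1)[OF is_group, of "{}"]]
    by (auto dest: subgroup.one_closed)
  then show ?thesis
    using trivial_factor_iso unfolding presented_group_def is_iso_def by auto
qed

text \<open>The relator expresses \<open>x\<close> through the other generators. Substituting this
  expression retracts \<open>F\<close> onto \<open>F'\<close>; followed by the quotient map modulo
  \<open>N'\<close> it is surjective with kernel \<open>N\<close>, and the first isomorphism theorem
  applies.\<close>

lemma presented_group_eliminate:
  assumes x: "x \<in> A" and A': "A' = A - {x}"
    and u: "set u \<subseteq> A' \<times> UNIV" and v: "set v \<subseteq> A' \<times> UNIV"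
    and red: "reduced (u @ (x, b) # v)"
    and R: "R \<subseteq> carrier (free_group A')"
  shows "presented_group A (insert (u @ (x, b) # v) R) \<cong> presented_group A' R"
proof -
  define F F' where "F = free_group A" and "F' = free_group A'"
  define r where "r = u @ (x, b) # v"
  define N N' where "N = normal_closure F (insert r R)" and "N' = normal_closure F' R"
  interpret F: group F unfolding F_def by (rule group_free_group)
  interpret F': group F' unfolding F'_def by (rule group_free_group)
  have sub: "subgroup (carrier F') F" and F'_eq: "F' = F \<lparr>carrier := carrier F'\<rparr>"
    using free_group_subset[of A' A] by (auto simp: F_def F'_def A')
  have F'_sub: "carrier F' \<subseteq> carrier F"
    by (rule subgroup.subset[OF sub])
  have uv: "u \<in> carrier F'" "v \<in> carrier F'"
    using u v reduced_appendD[OF red] reduced_appendD[of "u @ [(x, b)]" v] red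
    by (auto simp: F'_def carrier_free_group)
  have r: "r \<in> carrier F"
    using u v red x by (auto simp: r_def F_def A' carrier_free_group)
  have r_eq: "r = u \<otimes>\<^bsub>F\<^esub> ([(x, b)] \<otimes>\<^bsub>F\<^esub> v)"
    unfolding r_def F_def free_group_simps using split_as_product[OF red] .
  have y: "[(x, c)] \<in> carrier F" for c
    using x by (simp add: F_def generator_in_free_group)
  have RF: "insert r R \<subseteq> carrier F" and RF': "R \<subseteq> carrier F'"
    using r R F'_sub by (auto simp: F'_def)
  have N: "N \<lhd> F" "insert r R \<subseteq> N"
    unfolding N_def using normal_closure_normal[OF F.is_group RF] by auto
  have N': "N' \<lhd> F'" "R \<subseteq> N'"
    unfolding N'_def using normal_closure_normal[OF F'.is_group RF'] by auto
  interpret N: normal N F by (rule N)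
  interpret N': normal N' F' by (rule N')
  interpret Q: group "F Mod N" by (rule N.factorgroup_is_group)

  \<comment> \<open>Solving \<open>u x\<^sup>b v = 1\<close> for \<open>x\<^sup>b\<close>.\<close>
  define t where "t = inv\<^bsub>F'\<^esub> (v \<otimes>\<^bsub>F'\<^esub> u)"
  \<comment> \<open>For negative \<open>b\<close> the generator \<open>x\<close> itself goes to the
    inverse of \<open>t\<close>, so that the letter \<open>(x, b)\<close> goes to \<open>t\<close>
    in both cases.\<close>
  define f where "f = (\<lambda>a. if a = x then (if b then t else inv\<^bsub>F'\<^esub> t) else [(a, True)])"
  have t: "t \<in> carrier F'"
    using uv by (simp add: t_def)
  have f: "f ` A \<subseteq> carrier F'"
    using t F'.inv_closed[OF t] generator_in_free_group[of _ A' True]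
    by (auto simp: f_def A' F'_def)
  define \<psi> where "\<psi> = free_lift F' f"
  have \<psi>: "\<psi> \<in> hom F F'"
    unfolding \<psi>_def F_def by (rule F'.free_lift_hom[OF f])
  interpret \<psi>: group_hom F F' \<psi>
    using \<psi> by unfold_locales
  \<comment> \<open>\<open>\<psi>\<close> and the identity agree on the generators in
    \<open>A'\<close>, so \<open>\<psi>\<close> is a retraction onto \<open>F'\<close>.\<close>
  have \<psi>_id: "\<psi> w = w" if "w \<in> carrier F'" for w
  proof (rule F'.free_group_hom_eqI[of \<psi> A' "\<lambda>w. w" w])
    show "\<psi> \<in> hom (free_group A') F'"
      using \<psi> F'_sub F'_eq unfolding F'_def[symmetric] by (auto simp: hom_def F'_def F_def)
    show "\<psi> [(a, True)] = [(a, True)]" if "a \<in> A'" for a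
    proof -
      have "f a = [(a, True)]" "f a \<in> carrier F'"
        using that f by (auto simp: f_def A')
      then show ?thesis
        using F'.free_lift_generator[of f a] by (simp add: \<psi>_def)
    qed
  qed (use that in \<open>auto simp: hom_def F'_def\<close>)
  have \<psi>_y: "\<psi> [(x, b)] = t"
    using t by (auto simp: \<psi>_def f_def free_lift_simps)
  have \<psi>_r: "\<psi> r = \<one>\<^bsub>F'\<^esub>"
  proof -
    have "\<psi> r = u \<otimes>\<^bsub>F'\<^esub> (t \<otimes>\<^bsub>F'\<^esub> v)"
      unfolding r_eq using uv F'_sub y
      by (simp add: \<psi>.hom_mult \<psi>_id \<psi>_y subsetD)
    then show ?thesis
      using uv by (simp add: t_def F'.inv_mult_group F'.m_assoc F'.inv_solve_left)
  qed

  define \<pi> where "\<pi> = (\<lambda>w. N #>\<^bsub>F\<^esub> w)"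
  have \<pi>: "\<pi> \<in> hom F (F Mod N)"
    unfolding \<pi>_def by (rule N.r_coset_hom_Mod)
  interpret \<pi>: group_hom F "F Mod N" \<pi>
    using \<pi> by unfold_locales
  have \<pi>_one: "\<pi> w = \<one>\<^bsub>F Mod N\<^esub> \<longleftrightarrow> w \<in> N" if "w \<in> carrier F" for w
    using that F.coset_join1[of N w] F.coset_join2[of w N] N.is_subgroup
    by (auto simp: \<pi>_def FactGroup_def subgroup.subset)
  \<comment> \<open>Inverses in \<open>F\<close> and \<open>F'\<close> coincide, since both are the
    reversed word of inverse letters.\<close>
  have tF: "t \<in> carrier F" and t_eq: "t = inv\<^bsub>F\<^esub> (v \<otimes>\<^bsub>F\<^esub> u)"
  proof -
    show "t \<in> carrier F" using t F'_sub by auto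
    have "v \<otimes>\<^bsub>F'\<^esub> u \<in> carrier F'" using uv by simp
    then have "inv\<^bsub>F'\<^esub> (v \<otimes>\<^bsub>F'\<^esub> u) = inv\<^bsub>F\<^esub> (v \<otimes>\<^bsub>F'\<^esub> u)"
      using inv_free_group[of _ A'] inv_free_group[of _ A] F'_sub unfolding F'_def F_def
      by (metis subsetD)
    then show "t = inv\<^bsub>F\<^esub> (v \<otimes>\<^bsub>F\<^esub> u)"
      by (simp add: t_def F_def F'_def)
  qed
  \<comment> \<open>Modulo \<open>N\<close> the relation \<open>r = 1\<close> holds and can be
    solved for the letter \<open>(x, b)\<close>; the solution is the image of
    \<open>t\<close>.\<close>
  have \<pi>_y: "\<pi> t = \<pi> [(x, b)]"
  proof -
    have uvF: "u \<in> carrier F" "v \<in> carrier F" using uv F'_sub by auto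
    have "\<pi> u \<otimes>\<^bsub>F Mod N\<^esub> (\<pi> [(x, b)] \<otimes>\<^bsub>F Mod N\<^esub> \<pi> v) = \<pi> r"
      unfolding r_eq using uvF y by (simp add: \<pi>.hom_mult)
    also have "\<dots> = \<one>\<^bsub>F Mod N\<^esub>"
      using \<pi>_one[OF r] N by auto
    finally have "\<pi> [(x, b)] \<otimes>\<^bsub>F Mod N\<^esub> \<pi> v = inv\<^bsub>F Mod N\<^esub> \<pi> u"
      using uvF y by (metis Q.inv_equality Q.inv_inv Q.m_closed \<pi>.hom_closed)
    then have "\<pi> [(x, b)] = inv\<^bsub>F Mod N\<^esub> \<pi> u \<otimes>\<^bsub>F Mod N\<^esub> inv\<^bsub>F Mod N\<^esub> \<pi> v"
      using uvF y Q.inv_solve_right'[of "\<pi> [(x, b)]" "inv\<^bsub>F Mod N\<^esub> \<pi> u" "\<pi> v"]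
      by (metis Q.inv_closed Q.inv_solve_right \<pi>.hom_closed)
    then show ?thesis
      using uvF by (simp add: t_eq \<pi>.hom_inv \<pi>.hom_mult Q.inv_mult_group del: mult_FactGroup)
  qed
  \<comment> \<open>The substitution changes a word only modulo \<open>N\<close>; by uniqueness of
    homomorphisms it is enough to check generators.\<close>
  have \<pi>\<psi>: "\<pi> (\<psi> w) = \<pi> w" if "w \<in> carrier F" for w
  proof (rule Q.free_group_hom_eqI[of "\<lambda>w. \<pi> (\<psi> w)" A \<pi> w])
    have "\<psi> \<in> hom F F"
      using \<psi> F'_sub F'_eq by (auto simp: hom_def F'_def F_def)
    then show "(\<lambda>w. \<pi> (\<psi> w)) \<in> hom (free_group A) (F Mod N)"
      using hom_compose[of \<psi> F F \<pi> "F Mod N"] \<pi> by (simp add: o_def F_def)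
    show "\<pi> (\<psi> [(a, True)]) = \<pi> [(a, True)]" if a: "a \<in> A" for a
    proof (cases "a = x")
      case False
      then show ?thesis
        using \<psi>_id[of "[(a, True)]"] a by (simp add: F'_def A' generator_in_free_group)
    next
      case True
      show ?thesis
      proof (cases b)
        case True
        then show ?thesis using \<psi>_y \<pi>_y \<open>a = x\<close> by simp
      next
        case False
        \<comment> \<open>The relation speaks of the letter \<open>(x, b)\<close>, so for negative
          \<open>b\<close> the generator is treated as the inverse of that letter.\<close>
        have "[(x, True)] = inv\<^bsub>F\<^esub> [(x, b)]"
          using inv_free_group[of "[(x, b)]" A] y False by (simp add: F_def)
        moreover have "\<pi> (\<psi> (inv\<^bsub>F\<^esub> [(x, b)])) = inv\<^bsub>F Mod N\<^esub> \<pi> t"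
        proof -
          have "inv\<^bsub>F'\<^esub> t = inv\<^bsub>F\<^esub> t"
            using inv_free_group[of t A'] inv_free_group[of t A] t tF by (simp add: F_def F'_def)
          then show ?thesis
            using y tF by (simp add: \<psi>.hom_inv \<psi>_y \<pi>.hom_inv)
        qed
        ultimately show ?thesis
          using \<open>a = x\<close> y by (simp add: \<pi>_y \<pi>.hom_inv)
      qed
    qed
  qed (use \<pi> that in \<open>auto simp: F_def\<close>)

  define \<phi> where "\<phi> = (\<lambda>w. N' #>\<^bsub>F'\<^esub> \<psi> w)"
  have \<phi>: "\<phi> \<in> hom F (F' Mod N')"
    using hom_compose[OF \<psi> N'.r_coset_hom_Mod] by (simp add: \<phi>_def o_def)
  interpret \<phi>: group_hom F "F' Mod N'" \<phi>
    using \<phi> N'.factorgroup_is_group by (intro group_hom.intro group_hom_axioms.intro F.is_group)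
  have \<phi>_one: "\<phi> w = \<one>\<^bsub>F' Mod N'\<^esub> \<longleftrightarrow> \<psi> w \<in> N'" if "w \<in> carrier F" for w
    using that F'.coset_join1[of N' "\<psi> w"] F'.coset_join2[of "\<psi> w" N'] N'.is_subgroup
    by (auto simp: \<phi>_def FactGroup_def subgroup.subset)
  have "\<phi> ` carrier F = carrier (F' Mod N')"
  proof (intro equalityI subsetI)
    fix C assume "C \<in> carrier (F' Mod N')"
    then obtain w where "w \<in> carrier F'" "C = N' #>\<^bsub>F'\<^esub> w"
      by (auto simp: FactGroup_def RCOSETS_def)
    then show "C \<in> \<phi> ` carrier F"
      using F'_sub \<psi>_id by (auto simp: \<phi>_def intro!: image_eqI[of _ _ w])
  qed (use \<phi>.hom_closed in auto)
  moreover have "kernel F (F' Mod N') \<phi> = N"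
  proof (intro equalityI subsetI)
    fix w assume "w \<in> kernel F (F' Mod N') \<phi>"
    then have w: "w \<in> carrier F" "\<psi> w \<in> N'"
      using \<phi>_one by (auto simp: kernel_def)
    \<comment> \<open>\<open>N'\<close> is a closure in \<open>F'\<close> and \<open>N\<close> one
      in \<open>F\<close>. The trace of \<open>N\<close> on \<open>F'\<close> is normal there and
      contains \<open>R\<close>, hence contains \<open>N'\<close>.\<close>
    have "N \<inter> carrier F' \<lhd> F'"
    proof (rule F'.normal_invI)
      show "subgroup (N \<inter> carrier F') F'"
        using F.subgroups_Inter_pair[OF N.is_subgroup sub] F.subgroup_incl[OF _ sub] F'_eq
        by (metis inf_le2)
      fix g h assume g: "g \<in> carrier F'" and h: "h \<in> N \<inter> carrier F'"
      have "inv\<^bsub>F'\<^esub> g = inv\<^bsub>F\<^esub> g"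
        using inv_free_group[of g A'] inv_free_group[of g A] g F'_sub by (auto simp: F_def F'_def)
      then have "g \<otimes>\<^bsub>F'\<^esub> h \<otimes>\<^bsub>F'\<^esub> inv\<^bsub>F'\<^esub> g = g \<otimes>\<^bsub>F\<^esub> h \<otimes>\<^bsub>F\<^esub> inv\<^bsub>F\<^esub> g"
        by (simp add: F_def F'_def)
      moreover have "g \<otimes>\<^bsub>F\<^esub> h \<otimes>\<^bsub>F\<^esub> inv\<^bsub>F\<^esub> g \<in> N"
        using N.inv_op_closed2[of g h] g h F'_sub by auto
      ultimately show "g \<otimes>\<^bsub>F'\<^esub> h \<otimes>\<^bsub>F'\<^esub> inv\<^bsub>F'\<^esub> g \<in> N \<inter> carrier F'"
        using g h by (metis F'.inv_closed F'.m_closed IntD2 IntI)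
    qed
    then have "N' \<subseteq> N"
      using normal_closure_minimal[of "N \<inter> carrier F'" F' R] N(2) RF' unfolding N'_def by auto
    \<comment> \<open>\<open>\<psi> w\<close> lies in \<open>N'\<close> and so in \<open>N\<close>,
      and \<open>w\<close> is congruent to \<open>\<psi> w\<close> modulo \<open>N\<close>.\<close>
    then show "w \<in> N"
      using w \<pi>\<psi>[OF w(1)] \<pi>_one[of "\<psi> w"] \<pi>_one[of w] F'_sub \<psi>.hom_closed[OF w(1)] by auto
  next
    \<comment> \<open>Conversely, \<open>\<psi>\<close> kills \<open>r\<close> and fixes
      \<open>R\<close>, so the kernel is a normal subgroup containing all relators.\<close>
    have "\<psi> s \<in> N'" if "s \<in> insert r R" for s
      using that \<psi>_r \<psi>_id RF' N'(2) N'.is_subgroup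
      by (auto simp: subgroup.one_closed subset_iff)
    then have "insert r R \<subseteq> kernel F (F' Mod N') \<phi>"
      using RF \<phi>_one by (auto simp: kernel_def)
    then show "w \<in> kernel F (F' Mod N') \<phi>" if "w \<in> N" for w
      using that normal_closure_minimal[OF \<phi>.normal_kernel, of "insert r R"]
      unfolding N_def by blast
  qed
  ultimately show ?thesis
    using \<phi>.FactGroup_iso
    by (simp add: presented_group_def N_def N'_def F_def F'_def r_def)
qed

section \<open>Presentations that collapse to free groups\<close>

definition letter_count :: "'a word \<Rightarrow> 'a \<Rightarrow> nat" where
  "letter_count w x = count_list (map fst w) x"

text \<open>For finite \<open>R\<close>: the sum over an infinite \<open>S\<close> is \<open>0\<close>.\<close>

definition collapsible :: "'a word set \<Rightarrow> bool" where
  "collapsible R \<longleftrightarrow> (\<forall>S\<subseteq>R. S \<noteq> {} \<longrightarrow> (\<exists>x. (\<Sum>w\<in>S. letter_count w x) = 1))"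

text \<open>Induction on the number of relators: the condition for \<open>S = R\<close> yields a
  generator and a relator to eliminate together, and the condition is inherited by the remaining
  relators because it ranges over all subsets.\<close>

lemma collapsible_presented_group:
  assumes "finite R" "R \<subseteq> carrier (free_group A)" "collapsible R"
  shows "\<exists>Y\<subseteq>A. presented_group A R \<cong> free_group Y"
  using assms
proof (induction "card R" arbitrary: A R)
  case 0
  then show ?case using presented_group_empty by auto
next
  case (Suc k)
  then have "R \<noteq> {}" by auto
  then obtain x where "(\<Sum>w\<in>R. letter_count w x) = 1"
    using Suc.prems unfolding collapsible_def by blast
  \<comment> \<open>A sum of natural numbers equal to 1 has one summand 1 and all others 0.\<close>
  then obtain r where r: "r \<in> R" "letter_count r x = 1"
    and others: "\<And>s. s \<in> R \<Longrightarrow> r \<noteq> s \<Longrightarrow> letter_count s x = 0"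
    using sum_eq_1_iff[OF Suc.prems(1)] by metis
  have "x \<in> fst ` set r"
    using r(2) count_notin[of x "map fst r"] by (auto simp: letter_count_def)
  then obtain b where "(x, b) \<in> set r" by auto
  then obtain u v where split: "r = u @ (x, b) # v"
    by (meson split_list)
  have notin: "x \<notin> fst ` set u" "x \<notin> fst ` set v"
    using r(2) by (auto simp: split letter_count_def count_list_0_iff)
  define A' where "A' = A - {x}"
  define R' where "R' = R - {r}"
  have r_carrier: "r \<in> carrier (free_group A)"
    using Suc.prems r by auto
  have R': "R' \<subseteq> carrier (free_group A')"
  proof
    fix s assume s: "s \<in> R'"
    then have "x \<notin> fst ` set s"
      using others[of s] by (auto simp: R'_def letter_count_def count_list_0_iff)
    then show "s \<in> carrier (free_group A')"
      using s Suc.prems(2) by (force simp: R'_def A'_def carrier_free_group)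
  qed
  have elim: "presented_group A (insert r R') \<cong> presented_group A' R'"
    unfolding split
  proof (rule presented_group_eliminate[OF _ A'_def _ _ _ R'])
    show "x \<in> A" "reduced (u @ (x, b) # v)"
      using r_carrier by (auto simp: split carrier_free_group)
    show "set u \<subseteq> A' \<times> UNIV" "set v \<subseteq> A' \<times> UNIV"
      using r_carrier notin
      by (auto simp: split carrier_free_group A'_def intro: rev_image_eqI)
  qed
  obtain Y where Y: "Y \<subseteq> A'" "presented_group A' R' \<cong> free_group Y"
  proof -
    have "k = card R'" "finite R'" "collapsible R'"
      using Suc.hyps(2) Suc.prems r(1) by (auto simp: R'_def collapsible_def)
    then show thesis
      using Suc.hyps(1)[of R' A'] R' that by blast
  qed
  have "insert r R' = R"
    using r(1) by (auto simp: R'_def)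
  then show ?case
    using iso_trans[OF elim Y(2)] Y(1) by (auto simp: A'_def)
qed

lemma collapsible_is_free_group:
  fixes A :: "'a set"
  assumes "finite R" "R \<subseteq> carrier (free_group A)" "collapsible R"
  shows "is_free_group (presented_group A R)"
proof -
  obtain Y :: "'a set" where "presented_group A R \<cong> free_group Y"
    using collapsible_presented_group[OF assms] by auto
  \<comment> \<open>The basis must consist of elements of the type of the presented group, that is,
    of sets of words. Singletons of one-letter words embed the generators there.\<close>
  moreover have "inj (\<lambda>a :: 'a. {[(a, True)]})"
    by (auto intro: injI)
  ultimately show ?thesis
    using iso_trans[OF _ free_group_iso_image] group_presented_group[OF assms(2)]
    unfolding is_free_group_def by metis
qed


section \<open>Counting\<close>

lemma card_letters_not_collapsible:
  assumes "finite S" "\<And>w. w \<in> S \<Longrightarrow> length w = 4" "\<And>x. (\<Sum>w\<in>S. letter_count w x) \<noteq> 1"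
  shows "card (\<Union>w\<in>S. fst ` set w) \<le> 2 * card S"
proof -
  let ?L = "\<Union>w\<in>S. fst ` set w"
  have fin: "finite ?L" using assms(1) by auto
  have two: "2 \<le> (\<Sum>w\<in>S. letter_count w x)" if "x \<in> ?L" for x
  proof -
    obtain w where w: "w \<in> S" "x \<in> fst ` set w" using \<open>x \<in> ?L\<close> by auto
    then have "letter_count w x \<noteq> 0"
      by (auto simp: letter_count_def count_list_0_iff)
    then have "(\<Sum>w\<in>S. letter_count w x) \<noteq> 0"
      using w assms(1) by auto
    then show ?thesis using assms(3)[of x] by linarith
  qed
  have "2 * card ?L = (\<Sum>x\<in>?L. 2)" by simp
  also have "\<dots> \<le> (\<Sum>x\<in>?L. \<Sum>w\<in>S. letter_count w x)"
    by (rule sum_mono) (rule two)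
  also have "\<dots> = (\<Sum>w\<in>S. \<Sum>x\<in>?L. letter_count w x)"
    by (rule sum.swap)
  also have "\<dots> = (\<Sum>w\<in>S. 4)"
  proof (rule sum.cong)
    fix w assume w: "w \<in> S"
    \<comment> \<open>Letters missing from \<open>w\<close> contribute 0, and the others add up to
      the length of \<open>w\<close>.\<close>
    have "(\<Sum>x\<in>?L. letter_count w x) = (\<Sum>x\<in>set (map fst w). count_list (map fst w) x)"
      unfolding letter_count_def using w fin
      by (intro sum.mono_neutral_right) (auto simp: count_list_0_iff)
    then show "(\<Sum>x\<in>?L. letter_count w x) = 4"
      using sum_count_set[of "map fst w" "set (map fst w)"] assms(2)[OF w] by simp
  qed simp
  finally show ?thesis by simp
qed

section \<open>Counting supersets and bounding binomial coefficients\<close>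

lemma card_supersets:
  assumes "finite W" "S \<subseteq> W" "card S \<le> m"
  shows "card {R. R \<subseteq> W \<and> card R = m \<and> S \<subseteq> R} \<le> (card W - card S) choose (m - card S)"
proof -
  have fS: "finite S" using assms finite_subset by auto
  have "card {R. R \<subseteq> W \<and> card R = m \<and> S \<subseteq> R} \<le> card {T. T \<subseteq> W - S \<and> card T = m - card S}"
  \<comment> \<open>Each such \<open>R\<close> contains \<open>S\<close>, so it is determined by
    \<open>R - S\<close>.\<close>
  proof (rule card_inj_on_le[of "\<lambda>R. R - S"])
    show "inj_on (\<lambda>R. R - S) {R. R \<subseteq> W \<and> card R = m \<and> S \<subseteq> R}"
      by (auto intro!: inj_onI)
    show "(\<lambda>R. R - S) ` {R. R \<subseteq> W \<and> card R = m \<and> S \<subseteq> R}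
        \<subseteq> {T. T \<subseteq> W - S \<and> card T = m - card S}"
      using fS by (auto simp: card_Diff_subset)
    show "finite {T. T \<subseteq> W - S \<and> card T = m - card S}"
      using assms(1) by (auto intro: finite_subset[of _ "Pow W"])
  qed
  also have "\<dots> = (card W - card S) choose (m - card S)"
    using n_subsets[of "W - S"] assms fS by (simp add: card_Diff_subset)
  finally show ?thesis .
qed

text \<open>Lowering both arguments by one multiplies the coefficient by their ratio, here
  \<open>(m - i) / (N - i)\<close>, which is at most \<open>m / N\<close>.\<close>

lemma binomial_ratio_le:
  assumes "k \<le> m" "m \<le> N"
  shows "real ((N - k) choose (m - k)) \<le> real (N choose m) * (real m / real N) ^ k"
  using assms(1)
proof (induction k)
  case (Suc k)
  define a b where "a = N - Suc k" and "b = m - Suc k"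
  have ab: "N - k = Suc a" "m - k = Suc b"
    using Suc.prems assms(2) by (auto simp: a_def b_def)
  have "real (Suc b) * real (Suc a choose Suc b) = real (Suc a) * real (a choose b)"
    using Suc_times_binomial[of b a] by (metis of_nat_mult)
  then have "real (a choose b) = real (Suc b) / real (Suc a) * real (Suc a choose Suc b)"
    by (simp add: field_simps)
  also have "\<dots> \<le> real m / real N * real (Suc a choose Suc b)"
  proof (rule mult_right_mono)
    have "real (m - k) / real (N - k) \<le> real m / real N"
      using Suc.prems assms(2) mult_left_mono[of "real m" "real N" "real k"]
      by (simp add: of_nat_diff divide_simps) (simp add: algebra_simps)
    then show "real (Suc b) / real (Suc a) \<le> real m / real N"
      by (simp add: ab)
  qed simp
  also have "\<dots> \<le> real m / real N * (real (N choose m) * (real m / real N) ^ k)"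
    using Suc ab by (intro mult_left_mono) auto
  finally show ?case
    by (simp add: a_def b_def mult_ac)
qed simp

text \<open>\<open>k ^ k / k!\<close> is a single term of the exponential series at
  \<open>k\<close>.\<close>

lemma power_self_le_exp_fact: "real k ^ k \<le> exp 1 ^ k * fact k"
proof -
  have "(\<Sum>i\<in>{k}. real k ^ i /\<^sub>R fact i) \<le> (\<Sum>i. real k ^ i /\<^sub>R fact i)"
    by (rule sum_le_suminf[OF summable_exp_generic]) auto
  then have "real k ^ k / fact k \<le> exp (real k)"
    by (simp add: exp_def divide_inverse mult.commute)
  then show ?thesis
    using exp_of_nat_mult[of k "1::real"] by (simp add: divide_le_eq)
qed

lemma binomial_le_exp_power: "real (n choose k) \<le> (exp 1 * real n / real k) ^ k"
\<comment> \<open>For \<open>k = 0\<close> both sides are 1, as the quotient by zero carries the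
  exponent 0.\<close>
proof (cases "k = 0")
  case False
  have "real (n choose k) * real k ^ k \<le> real (n choose k) * (exp 1 ^ k * fact k)"
    by (intro mult_left_mono power_self_le_exp_fact) simp
  also have "\<dots> = exp 1 ^ k * real ((n choose k) * fact k)"
    by simp
  also have "\<dots> \<le> exp 1 ^ k * real (n ^ k)"
    by (intro mult_left_mono of_nat_mono binomial_fact_pow) simp
  finally show ?thesis
    using False by (simp add: power_mult_distrib power_divide field_simps)
qed simp

text \<open>The three factors count the choices of \<open>2 * k\<close> letters, of \<open>k\<close>
  words in these letters, and of the remaining relators; each is replaced by its power
  bound.\<close>

lemma union_bound_summand:
  assumes "1 \<le> k" "k \<le> m" "m \<le> n ^ 4" "1 \<le> n"
  shows "real ((n choose (2 * k)) * (((2 * k) ^ 4) choose k) * ((n ^ 4 - k) choose (m - k)))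
    \<le> real (n ^ 4 choose m) * (4 * exp 1 ^ 3 * real m ^ 2 / real n ^ 2) ^ k"
proof -
  define e :: real where "e = exp 1"
  have e: "e > 0" by (simp add: e_def)
  have "real ((n choose (2 * k)) * (((2 * k) ^ 4) choose k) * ((n ^ 4 - k) choose (m - k)))
    \<le> (e * real n / real (2 * k)) ^ (2 * k) * (e * real ((2 * k) ^ 4) / real k) ^ k
       * (real (n ^ 4 choose m) * (real m / real (n ^ 4)) ^ k)"
    unfolding of_nat_mult[of "_ * _"] of_nat_mult[of "n choose (2 * k)"] e_def
    by (intro mult_mono binomial_le_exp_power binomial_ratio_le assms) auto
  also have "\<dots> = real (n ^ 4 choose m)
       * ((e * real n / real (2 * k)) ^ 2 * (e * real ((2 * k) ^ 4) / real k) * (real m / real (n ^ 4))) ^ k"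
    by (simp only: power_mult power_mult_distrib[of _ _ k]) (simp only: mult_ac)
  \<comment> \<open>The letters give \<open>k\<close> to the power -2 and the words give
    \<open>k\<close> to the power 3, leaving one factor \<open>k\<close>.\<close>
  also have "(e * real n / real (2 * k)) ^ 2 * (e * real ((2 * k) ^ 4) / real k) * (real m / real (n ^ 4))
      = 4 * e ^ 3 * (real k * real m) / real n ^ 2"
    using assms by (simp add: divide_simps) (simp add: algebra_simps power_numeral_reduce)
  \<comment> \<open>Bounding this \<open>k\<close> by \<open>m\<close> makes the base independent of
    \<open>k\<close>, so the later sum is geometric.\<close>
  also have "real (n ^ 4 choose m) * (4 * e ^ 3 * (real k * real m) / real n ^ 2) ^ k
      \<le> real (n ^ 4 choose m) * (4 * e ^ 3 * real m ^ 2 / real n ^ 2) ^ k"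
    using assms e unfolding power2_eq_square[of "real m"]
    by (intro mult_left_mono power_mono divide_right_mono mult_right_mono) auto
  finally show ?thesis by (simp add: e_def)
qed

text \<open>Union bound over a witness \<open>S\<close> of failure, its size \<open>k\<close>, and a
  set \<open>V\<close> of generators that contains the letters of \<open>S\<close>.\<close>

lemma card_not_collapsible:
  assumes "2 * m \<le> n"
  shows "card {R. R \<subseteq> positive_words n \<and> card R = m \<and> \<not> collapsible R}
    \<le> (\<Sum>k=1..m. (n choose (2 * k)) * (((2 * k) ^ 4) choose k) * ((n ^ 4 - k) choose (m - k)))"
proof -
  define W where "W = (\<lambda>V :: nat set. {w :: nat word. length w = 4 \<and> set w \<subseteq> V \<times> {True}})"
  define \<V> where "\<V> = (\<lambda>k. {V. V \<subseteq> gens n \<and> card V = 2 * k})"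
  define \<S> where "\<S> = (\<lambda>k V. {S. S \<subseteq> W V \<and> card S = k})"
  define \<R> where "\<R> = (\<lambda>S. {R. R \<subseteq> positive_words n \<and> card R = m \<and> S \<subseteq> R})"
  have cardW: "card (W V) = card V ^ 4" and finW: "finite (W V)" if "finite V" for V
    using finite_lists_length_eq[of "V \<times> {True}" 4] card_lists_length_eq[of "V \<times> {True}" 4] that
    by (simp_all add: W_def conj_commute card_cartesian_product)
  have fin_gens: "finite (gens n)" "card (gens n) = n"
    by (simp_all add: gens_def)
  have fin_V: "finite V" if "V \<in> \<V> k" for V k
    using that fin_gens finite_subset by (auto simp: \<V>_def)
  have "{R. R \<subseteq> positive_words n \<and> card R = m \<and> \<not> collapsible R}
      \<subseteq> (\<Union>k\<in>{1..m}. \<Union>V\<in>\<V> k. \<Union>S\<in>\<S> k V. \<R> S)"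
  proof
    fix R assume "R \<in> {R. R \<subseteq> positive_words n \<and> card R = m \<and> \<not> collapsible R}"
    then have R: "R \<subseteq> positive_words n" "card R = m" "\<not> collapsible R" by auto
    then obtain S where S: "S \<subseteq> R" "S \<noteq> {}" "\<And>x. (\<Sum>w\<in>S. letter_count w x) \<noteq> 1"
      unfolding collapsible_def by auto
    have finR: "finite R"
      using R(1) card_positive_words(1) finite_subset by blast
    then have finS: "finite S"
      using S(1) finite_subset by blast
    let ?L = "\<Union>w\<in>S. fst ` set w"
    have "card ?L \<le> 2 * card S"
      using R(1) S finS
      by (intro card_letters_not_collapsible) (auto simp: positive_words_def)
    \<comment> \<open>Excluding \<open>k = 0\<close> matters: that summand would count all relator
      sets.\<close>
    moreover have k: "card S \<in> {1..m}"
      using S finS card_mono[OF finR S(1)] R(2) card_gt_0_iff[of S] by auto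
    moreover have "?L \<subseteq> gens n"
      using R(1) S(1) by (force simp: positive_words_def)
    \<comment> \<open>There are enough generators to enlarge the letters of \<open>S\<close> to a
      set of exactly \<open>2 * card S\<close>.\<close>
    moreover have "2 * card S \<le> card (gens n)"
      using k assms fin_gens by auto
    ultimately obtain V where V: "?L \<subseteq> V" "V \<subseteq> gens n" "card V = 2 * card S"
      using exists_subset_between[of ?L "2 * card S" "gens n"] fin_gens by auto
    have "S \<subseteq> W V"
    proof
      fix w assume w: "w \<in> S"
      then have "length w = 4" "set w \<subseteq> gens n \<times> {True}" "fst ` set w \<subseteq> V"
        using V(1) R(1) S(1) by (auto simp: positive_words_def)
      then show "w \<in> W V"
        by (auto simp: W_def)
    qed
    then show "R \<in> (\<Union>k\<in>{1..m}. \<Union>V\<in>\<V> k. \<Union>S\<in>\<S> k V. \<R> S)"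
      using V k R S(1) by (auto simp: \<V>_def \<S>_def \<R>_def intro!: bexI[of _ "card S"])
  qed
  moreover have "finite (\<Union>k\<in>{1..m}. \<Union>V\<in>\<V> k. \<Union>S\<in>\<S> k V. \<R> S)"
    by (rule finite_subset[of _ "Pow (positive_words n)"])
      (auto simp: \<R>_def card_positive_words)
  ultimately have "card {R. R \<subseteq> positive_words n \<and> card R = m \<and> \<not> collapsible R}
      \<le> card (\<Union>k\<in>{1..m}. \<Union>V\<in>\<V> k. \<Union>S\<in>\<S> k V. \<R> S)"
    by (rule card_mono[rotated])
  also have "\<dots> \<le> (\<Sum>k=1..m. card (\<Union>V\<in>\<V> k. \<Union>S\<in>\<S> k V. \<R> S))"
    by (rule card_UN_le) simp
  also have "\<dots> \<le> (\<Sum>k=1..m. (n choose (2 * k)) * (((2 * k) ^ 4) choose k) * ((n ^ 4 - k) choose (m - k)))"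
  proof (rule sum_mono)
    fix k assume k: "k \<in> {1..m}"
    have "finite (\<V> k)"
      by (rule finite_subset[of _ "Pow (gens n)"]) (auto simp: \<V>_def fin_gens)
    then have "card (\<Union>V\<in>\<V> k. \<Union>S\<in>\<S> k V. \<R> S) \<le> (\<Sum>V\<in>\<V> k. card (\<Union>S\<in>\<S> k V. \<R> S))"
      by (rule card_UN_le)
    also have "\<dots> \<le> (\<Sum>V\<in>\<V> k. (((2 * k) ^ 4) choose k) * ((n ^ 4 - k) choose (m - k)))"
    proof (rule sum_mono)
      fix V assume V: "V \<in> \<V> k"
      have "finite (\<S> k V)"
        by (rule finite_subset[of _ "Pow (W V)"]) (auto simp: \<S>_def finW[OF fin_V[OF V]])
      then have "card (\<Union>S\<in>\<S> k V. \<R> S) \<le> (\<Sum>S\<in>\<S> k V. card (\<R> S))"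
        by (rule card_UN_le)
      also have "\<dots> \<le> (\<Sum>S\<in>\<S> k V. (n ^ 4 - k) choose (m - k))"
      proof (rule sum_mono)
        fix S assume S: "S \<in> \<S> k V"
        have "S \<subseteq> positive_words n"
          using S V by (fastforce simp: \<S>_def \<V>_def W_def positive_words_def)
        then show "card (\<R> S) \<le> (n ^ 4 - k) choose (m - k)"
          using card_supersets[OF card_positive_words(1), of S n m] S k
          by (simp add: \<R>_def \<S>_def card_positive_words)
      qed
      also have "\<dots> = (((2 * k) ^ 4) choose k) * ((n ^ 4 - k) choose (m - k))"
        using n_subsets[OF finW[OF fin_V[OF V]], of k] cardW[OF fin_V[OF V]] V
        by (simp add: \<S>_def \<V>_def)
      finally show "card (\<Union>S\<in>\<S> k V. \<R> S)
          \<le> (((2 * k) ^ 4) choose k) * ((n ^ 4 - k) choose (m - k))" .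
    qed
    also have "\<dots> = (n choose (2 * k)) * (((2 * k) ^ 4) choose k) * ((n ^ 4 - k) choose (m - k))"
      using n_subsets[OF fin_gens(1), of "2 * k"] fin_gens(2) by (simp add: \<V>_def)
    finally show "card (\<Union>V\<in>\<V> k. \<Union>S\<in>\<S> k V. \<R> S)
        \<le> (n choose (2 * k)) * (((2 * k) ^ 4) choose k) * ((n ^ 4 - k) choose (m - k))" .
  qed
  finally show ?thesis .
qed

section \<open>From counts to probabilities and the limit\<close>

lemma geometric_sum_le:
  fixes q :: real
  assumes "0 \<le> q" "q \<le> 1 / 2"
  shows "(\<Sum>k=1..m. q ^ k) \<le> 2 * q"
proof -
  \<comment> \<open>The product telescopes; afterwards \<open>1 - q\<close> is bounded below by
    \<open>1 / 2\<close>.\<close>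
  have "(1 - q) * (\<Sum>k=1..m. q ^ k) = q - q ^ Suc m"
    by (induction m) (simp_all add: distrib_left, simp add: algebra_simps)
  also have "\<dots> \<le> q"
    using assms by simp
  finally have "(1 - q) * (\<Sum>k=1..m. q ^ k) \<le> q" .
  moreover have "1 / 2 * (\<Sum>k=1..m. q ^ k) \<le> (1 - q) * (\<Sum>k=1..m. q ^ k)"
    using assms by (intro mult_right_mono sum_nonneg) auto
  ultimately show ?thesis by linarith
qed

lemma prob_not_collapsible_le:
  assumes "2 * m \<le> n" "1 \<le> n" and q: "q = 4 * exp 1 ^ 3 * real m ^ 2 / real n ^ 2" "q \<le> 1 / 2"
  shows "real (card {R. R \<subseteq> positive_words n \<and> card R = m \<and> \<not> collapsible R})
    \<le> real (n ^ 4 choose m) * (2 * q)"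
proof -
  have mn: "m \<le> n ^ 4"
    using assms(1,2) self_le_power[of n 4] by linarith
  have "real (card {R. R \<subseteq> positive_words n \<and> card R = m \<and> \<not> collapsible R})
    \<le> (\<Sum>k=1..m. real ((n choose (2 * k)) * (((2 * k) ^ 4) choose k) * ((n ^ 4 - k) choose (m - k))))"
    using card_not_collapsible[OF assms(1)] unfolding of_nat_sum[symmetric] by (rule of_nat_mono)
  also have "\<dots> \<le> (\<Sum>k=1..m. real (n ^ 4 choose m) * q ^ k)"
    unfolding q(1) using assms(2) mn by (intro sum_mono union_bound_summand) auto
  also have "\<dots> = real (n ^ 4 choose m) * (\<Sum>k=1..m. q ^ k)"
    by (simp add: sum_distrib_left)
  also have "\<dots> \<le> real (n ^ 4 choose m) * (2 * q)"
    using q by (intro mult_left_mono geometric_sum_le) auto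
  finally show ?thesis .
qed

lemma prob_is_free_group_ge:
  assumes d: "d \<le> 1" and n: "1 \<le> n" and small: "2 * real n powr (4 * d) \<le> real n"
    and q: "q = 4 * exp 1 ^ 3 * (real n powr (4 * d)) ^ 2 / real n ^ 2" "q \<le> 1 / 2"
  shows "1 - 2 * q \<le> measure_pmf.prob (positive_square_model d n) {G. is_free_group G}"
proof -
  define m where "m = nat \<lfloor>real n powr (4 * d)\<rfloor>"
  \<comment> \<open>The union bound uses the integer \<open>m\<close>, while the limit is taken with
    the real power. Rounding down gives \<open>q' \<le> q\<close>.\<close>
  define q' where "q' = 4 * exp 1 ^ 3 * real m ^ 2 / real n ^ 2"
  define B where "B = {R \<in> relator_sets d n. \<not> collapsible R}"
  have m: "real m \<le> real n powr (4 * d)"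
    by (simp add: m_def)
  then have "q' \<le> q"
    unfolding q'_def q(1)
    by (intro divide_right_mono mult_left_mono power_mono) auto
  have RS: "relator_sets d n = {R. R \<subseteq> positive_words n \<and> card R = m}"
    by (simp add: relator_sets_def m_def)
  have card_RS: "card (relator_sets d n) = n ^ 4 choose m"
    using n_subsets[OF card_positive_words(1), of n m] by (simp add: RS card_positive_words)
  have ne: "relator_sets d n \<noteq> {}" and fin: "finite (relator_sets d n)"
    using relator_sets_nonempty[OF n d] finite_relator_sets by auto
  then have pos: "real (n ^ 4 choose m) > 0"
    using card_RS card_gt_0_iff[of "relator_sets d n"] by simp
  have "2 * m \<le> n"
    using m small by linarith
  moreover have "B = {R. R \<subseteq> positive_words n \<and> card R = m \<and> \<not> collapsible R}"
    by (auto simp: B_def RS)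
  ultimately have "real (card B) \<le> real (n ^ 4 choose m) * (2 * q')"
    using prob_not_collapsible_le[OF _ n q'_def] \<open>q' \<le> q\<close> q(2) by simp
  then have "real (card B) / real (n ^ 4 choose m) \<le> 2 * q'"
    using pos by (simp add: divide_le_eq mult.commute)
  then have B: "measure_pmf.prob (pmf_of_set (relator_sets d n)) B \<le> 2 * q"
    using \<open>q' \<le> q\<close> measure_pmf_of_set[OF ne fin, of B]
    by (simp add: card_RS B_def Int_def conj_ac)
  have "is_free_group (presented_group (gens n) R)" if "R \<in> relator_sets d n" "R \<notin> B" for R
  proof (rule collapsible_is_free_group)
    show "finite R" "R \<subseteq> carrier (free_group (gens n))" "collapsible R"
      using that positive_words_subset[of n] card_positive_words(1) finite_subset
      by (auto simp: B_def RS)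
  qed
  \<comment> \<open>The inclusion is known only for sets in the support of the uniform distribution,
    hence monotonicity almost everywhere.\<close>
  then have "measure_pmf.prob (pmf_of_set (relator_sets d n)) (- B)
      \<le> measure_pmf.prob (pmf_of_set (relator_sets d n))
          (presented_group (gens n) -` {G. is_free_group G})"
    using ne fin by (intro measure_pmf.finite_measure_mono_AE) (auto simp: AE_measure_pmf_iff)
  moreover have "measure_pmf.prob (pmf_of_set (relator_sets d n)) (- B)
      = 1 - measure_pmf.prob (pmf_of_set (relator_sets d n)) B"
    using measure_pmf.prob_compl[of B "pmf_of_set (relator_sets d n)"]
    by (simp add: Compl_eq_Diff_UNIV)
  ultimately show ?thesis
    using B by (simp add: positive_square_model_def)
qed

theorem theorem4p1:
  fixes d :: real
  assumes "0 < d" and "d < 1 / 4"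
  shows "with_overwhelming_probability (positive_square_model d) is_free_group"
proof -
  define q where "q = (\<lambda>n :: nat. 4 * exp 1 ^ 3 * (real n powr (4 * d)) ^ 2 / real n ^ 2)"
  \<comment> \<open>Here \<open>d < 1 / 4\<close> enters: \<open>4 * d < 1\<close>, and
    \<open>q n\<close> is a constant times \<open>n\<close> to the negative power
    \<open>8 * d - 2\<close>.\<close>
  have q: "q \<longlonglongrightarrow> 0" and small: "eventually (\<lambda>n. 2 * real n powr (4 * d) \<le> real n) sequentially"
    using assms unfolding q_def by real_asymp+
  have "eventually (\<lambda>n. q n \<le> 1 / 2) sequentially"
    using order_tendstoD(2)[OF q, of "1 / 2"] by (auto elim: eventually_mono)
  with small eventually_ge_at_top[of 1]
  have "eventually (\<lambda>n. 1 - 2 * q n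
      \<le> measure_pmf.prob (positive_square_model d n) {G. is_free_group G}) sequentially"
    by eventually_elim (use assms in \<open>auto intro!: prob_is_free_group_ge q_def[THEN fun_cong]\<close>)
  moreover have "eventually (\<lambda>n. measure_pmf.prob (positive_square_model d n)
      {G. is_free_group G} \<le> 1) sequentially"
    by simp
  moreover have "(\<lambda>n. 1 - 2 * q n) \<longlonglongrightarrow> 1"
    using tendsto_diff[OF tendsto_const tendsto_mult[OF tendsto_const q], of 1 2] by simp
  ultimately show ?thesis
    unfolding with_overwhelming_probability_def
    by (rule tendsto_sandwich[OF _ _ _ tendsto_const])
qed

end
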